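(* Let $G_1=(V_1,E_1)$ be a $d$-regular graph and let $G_2=(V_2,E_2)$, with $d=|V_2|$. If the neighborhood graph $\mathcal{N}$ of $G_2$ is connected, then $G_1\circ_z G_2$ is connected as well.
   Context: $G_1$ is a finite connected $d$-regular bi-labelled graph and $G_2$ a finite connected regular bi-labelled graph with $|V_2|=d$ (identified with $[d]=\{1,\dots,d\}$). Bi-labelling: at each vertex the incident edges get distinct colors, encoded by a rotation map $\operatorname{Rot}_G(v,h)=(w,k)$ meaning an edge joining $v$ and $w$ colored $h$ near $v$ and $k$ near $w$. The zig-zag product $G_1\circ_z G_2$ has vertex set $V_1\times V_2$ and rotation map $\operatorname{Rot}((v,k),(i,j))=((w,l),(j',i'))$ whenever $\operatorname{Rot}_{G_2}(k,i)=(k',i')$, $\operatorname{Rot}_{G_1}(v,k')=(w,l')$, $\operatorname{Rot}_{G_2}(l',j)=(l,j')$. For $h\in V_2$ let $N_h=\{h'\in V_2: h\sim h'\}$. The neighborhood graph $\mathcal{N}=(\mathcal{V},\mathcal{E})$ of $G_2$ has vertex set $\mathcal{V}=\{N_h: h\in V_2\}$ and edge set $\mathcal{E}=\{\{N_h,N_k\}: N_h\cap N_k\neq\emptyset,\ h\neq k\}$, i.e. $N_h,N_k$ are adjacent iff $h\ne k$ have a common neighbor in $G_2$.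
   Formalization: The degree of G_2 is assumed to be at least 1; this excludes only G_2 = a single vertex without edges (d = 1), where the claim fails: for G_1 = K_2 the neighborhood graph is one vertex, hence connected, but the zig-zag product is two isolated vertices. *)

theory Defs
  imports "Graph_Theory.Graph_Theory"
begin

text \<open>
  A bi-labelled regular multigraph is given by its vertices, its colours and its rotation map:
  \<open>rot G (v, h) = (w, k)\<close> says that an edge joining \<open>v\<close> and \<open>w\<close> is coloured \<open>h\<close> near \<open>v\<close> and
  \<open>k\<close> near \<open>w\<close>. The edges are the orbits \<open>{(v, h), rot G (v, h)}\<close>, so loops and parallel edges
  are allowed. Every vertex carries each colour exactly once, so the degree is the number of
  colours.
\<close>

record ('v, 'c) bilabelled =
  vertices :: "'v set"
  colours :: "'c set"
  rot :: "'v \<times> 'c \<Rightarrow> 'v \<times> 'c"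

locale bilabelled_graph =
  fixes G :: "('v, 'c) bilabelled" and d :: nat
  assumes finite_vertices: "finite (vertices G)"
    and finite_colours: "finite (colours G)"
    and degree: "card (colours G) = d"
    and rot_closed: "x \<in> vertices G \<times> colours G \<Longrightarrow> rot G x \<in> vertices G \<times> colours G"
    and rot_rot: "x \<in> vertices G \<times> colours G \<Longrightarrow> rot G (rot G x) = x"

text \<open>
  The underlying multigraph as a symmetric digraph: each pair of a vertex and a colour is an arc
  leaving that vertex, and its reverse is its image under the rotation map.
\<close>

definition graph_of :: "('v, 'c) bilabelled \<Rightarrow> ('v, 'v \<times> 'c) pre_digraph" where
  "graph_of G = \<lparr> verts = vertices G, arcs = vertices G \<times> colours G,
                  tail = fst, head = (\<lambda>x. fst (rot G x)) \<rparr>"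

lemma (in bilabelled_graph) pseudo_graph_graph_of: "pseudo_graph (graph_of G)"
proof
  fix e assume e: "e \<in> arcs (graph_of G)"
  then show "tail (graph_of G) e \<in> verts (graph_of G)"
    by (auto simp: graph_of_def)
  from e rot_closed[of e] show "head (graph_of G) e \<in> verts (graph_of G)"
    by (auto simp: graph_of_def mem_Times_iff)
next
  show "finite (verts (graph_of G))" "finite (arcs (graph_of G))"
    using finite_vertices finite_colours by (auto simp: graph_of_def)
next
  show "symmetric (graph_of G)"
    unfolding symmetric_def
  proof (rule symI)
    fix u v assume "u \<rightarrow>\<^bsub>graph_of G\<^esub> v"
    then obtain x where x: "x \<in> vertices G \<times> colours G" "u = fst x" "v = fst (rot G x)"
      by (auto simp: arcs_ends_def arc_to_ends_def graph_of_def)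
    with rot_closed[of x] rot_rot[of x] show "v \<rightarrow>\<^bsub>graph_of G\<^esub> u"
      by (auto simp: arcs_ends_def arc_to_ends_def graph_of_def intro!: image_eqI[of _ _ "rot G x"])
  qed
qed

text \<open>
  The zig-zag product is meaningful when the colours of \<open>G1\<close> are the vertices of \<open>G2\<close>.
\<close>

definition zigzag ::
  "('a, 'b) bilabelled \<Rightarrow> ('b, 'c) bilabelled \<Rightarrow> ('a \<times> 'b, 'c \<times> 'c) bilabelled" where
  "zigzag G1 G2 =
     \<lparr> vertices = vertices G1 \<times> vertices G2,
       colours = colours G2 \<times> colours G2,
       rot = (\<lambda>((v, k), (i, j)).
                let (k', i') = rot G2 (k, i);
                    (w, l') = rot G1 (v, k');
                    (l, j') = rot G2 (l', j)
                in ((w, l), (j', i'))) \<rparr>"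

lemma bilabelled_graph_zigzag:
  assumes "bilabelled_graph G1 d" "bilabelled_graph G2 e" "colours G1 = vertices G2"
  shows "bilabelled_graph (zigzag G1 G2) (e\<^sup>2)"
proof -
  interpret G1: bilabelled_graph G1 d by fact
  interpret G2: bilabelled_graph G2 e by fact
  have *: "rot (zigzag G1 G2) x \<in> vertices (zigzag G1 G2) \<times> colours (zigzag G1 G2) \<and>
      rot (zigzag G1 G2) (rot (zigzag G1 G2) x) = x"
    if "x \<in> vertices (zigzag G1 G2) \<times> colours (zigzag G1 G2)" for x
  proof -
    obtain v k i j where x: "x = ((v, k), (i, j))" by (metis surj_pair)
    obtain k' i' where r1: "rot G2 (k, i) = (k', i')" by (metis surj_pair)
    obtain w l' where r2: "rot G1 (v, k') = (w, l')" by (metis surj_pair)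
    obtain l j' where r3: "rot G2 (l', j) = (l, j')" by (metis surj_pair)
    have m: "v \<in> vertices G1" "k \<in> vertices G2" "i \<in> colours G2" "j \<in> colours G2"
      using that x by (auto simp: zigzag_def)
    have m1: "k' \<in> vertices G2" "i' \<in> colours G2" "rot G2 (k', i') = (k, i)"
      using G2.rot_closed[of "(k, i)"] G2.rot_rot[of "(k, i)"] m r1 by auto
    have m2: "w \<in> vertices G1" "l' \<in> vertices G2" "rot G1 (w, l') = (v, k')"
      using G1.rot_closed[of "(v, k')"] G1.rot_rot[of "(v, k')"] m m1 r2 assms(3) by auto
    have m3: "l \<in> vertices G2" "j' \<in> colours G2" "rot G2 (l, j') = (l', j)"
      using G2.rot_closed[of "(l', j)"] G2.rot_rot[of "(l', j)"] m m2 r3 by auto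
    show ?thesis
      using m m1 m2 m3 r1 r2 r3 by (simp add: x zigzag_def)
  qed
  show ?thesis
    by unfold_locales
      (use * in \<open>auto simp: zigzag_def G1.finite_vertices G2.finite_vertices G2.finite_colours
         card_cartesian_product G2.degree power2_eq_square\<close>)
qed

definition nbhd :: "('v, 'c) bilabelled \<Rightarrow> 'v \<Rightarrow> 'v set" where
  "nbhd G h = {h' \<in> vertices G. h \<rightarrow>\<^bsub>graph_of G\<^esub> h'}"

text \<open>
  The vertices are the sets \<open>N\<^sub>h\<close> themselves, so distinct \<open>h\<close>, \<open>k\<close> with \<open>N\<^sub>h = N\<^sub>k\<close> give one vertex.
  Each undirected edge \<open>{N\<^sub>h, N\<^sub>k}\<close> appears as the two arcs \<open>(N\<^sub>h, N\<^sub>k)\<close> and \<open>(N\<^sub>k, N\<^sub>h)\<close>.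
\<close>

definition neighborhood_graph :: "('v, 'c) bilabelled \<Rightarrow> 'v set pair_pre_digraph" where
  "neighborhood_graph G =
     \<lparr> pverts = nbhd G ` vertices G,
       parcs = {(nbhd G h, nbhd G k) | h k.
                  h \<in> vertices G \<and> k \<in> vertices G \<and> nbhd G h \<inter> nbhd G k \<noteq> {} \<and> h \<noteq> k} \<rparr>"

end

theory Submission
  imports Defs
begin

text \<open>
  If \<open>h\<close> and \<open>k\<close> have a common neighbour \<open>m\<close> in \<open>G\<^sub>2\<close>, then \<open>(v, h)\<close> and \<open>(v, k)\<close> have a common
  neighbour in the zig-zag product: both can make the first \<open>G\<^sub>2\<close>-step to \<open>m\<close> and continue
  identically from there. Connectedness of the neighbourhood graph therefore puts each fibre
  \<open>{v} \<times> V\<^sub>2\<close> inside one component, and every edge of \<open>G\<^sub>1\<close> lies under an edge of the product, so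
  the fibres are joined to each other along paths of \<open>G\<^sub>1\<close>.
\<close>

text \<open>Connectedness is reachability in the symmetric closure, whose paths may run against arcs
  of \<open>G\<close>. Hence the invariance of \<open>P\<close> is required in both
  directions.\<close>

lemma connected_induct:
  assumes "Digraph_Component.connected G" "u \<in> verts G" "v \<in> verts G"
    and "P u" and inv: "\<And>e. e \<in> arcs G \<Longrightarrow> P (tail G e) \<longleftrightarrow> P (head G e)"
  shows "P v"
proof -
  have "u \<rightarrow>\<^sup>*\<^bsub>with_proj (mk_symmetric G)\<^esub> v"
    using assms(1-3) by (auto simp: connected_def strongly_connected_def)
  then show ?thesis
    unfolding reachable_def
  proof (induction rule: rtrancl_on_induct)
    case base
    show ?case by fact
  next
    case (step x y)
    then show ?case using inv by (auto simp: parcs_mk_symmetric)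
  qed
qed

lemma dominates_graph_of_iff:
  "u \<rightarrow>\<^bsub>graph_of G\<^esub> v \<longleftrightarrow> u \<in> vertices G \<and> (\<exists>c\<in>colours G. fst (rot G (u, c)) = v)"
  by (force simp: arcs_ends_def arc_to_ends_def graph_of_def)

context bilabelled_graph
begin

lemma nbhd_nonempty:
  assumes "0 < d" "h \<in> vertices G"
  shows "nbhd G h \<noteq> {}"
proof -
  obtain c where c: "c \<in> colours G"
    using degree assms(1) by fastforce
  then have "fst (rot G (h, c)) \<in> nbhd G h"
    using rot_closed[of "(h, c)"] assms(2)
    by (auto simp: nbhd_def dominates_graph_of_iff mem_Times_iff)
  then show ?thesis by blast
qed

lemma nbhd_sym:
  assumes "h \<in> nbhd G k"
  shows "k \<in> nbhd G h"
proof -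
  interpret pseudo_graph "graph_of G" by (rule pseudo_graph_graph_of)
  have "h \<rightarrow>\<^bsub>graph_of G\<^esub> k"
    using assms sym_arcs by (auto simp: nbhd_def symmetric_def dest: symD)
  then show ?thesis
    using assms by (auto simp: nbhd_def dominates_graph_of_iff[of k])
qed

end

text \<open>An arc of the product is a step in \<open>G2\<close>, the step in \<open>G1\<close>
  coloured by the vertex reached, and another step in \<open>G2\<close>. The colours
  \<open>i\<close> and \<open>j\<close> choose the two outer steps independently, so any pair of
  neighbours can be prescribed.\<close>

lemma dominates_zigzag:
  assumes "k' \<in> nbhd G2 k" "rot G1 (v, k') = (w, l')" "l \<in> nbhd G2 l'" "v \<in> vertices G1"
  shows "(v, k) \<rightarrow>\<^bsub>graph_of (zigzag G1 G2)\<^esub> (w, l)"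
proof -
  obtain i where i: "k \<in> vertices G2" "i \<in> colours G2" "fst (rot G2 (k, i)) = k'"
    using assms(1) by (auto simp: nbhd_def dominates_graph_of_iff)
  obtain j where j: "j \<in> colours G2" "fst (rot G2 (l', j)) = l"
    using assms(3) by (auto simp: nbhd_def dominates_graph_of_iff)
  have "fst (rot (zigzag G1 G2) ((v, k), (i, j))) = (w, l)"
    using i j assms(2) by (auto simp: zigzag_def split: prod.splits)
  then show ?thesis
    using i j assms(4) by (auto simp: dominates_graph_of_iff zigzag_def)
qed

text \<open>Positivity of \<open>e\<close> excludes a real counterexample: if \<open>G2\<close> is a
  single vertex without colours and \<open>G1\<close> a single edge, the neighbourhood graph is
  connected, but the product has two vertices and no arcs.\<close>

locale zigzag_factors =
  G1: bilabelled_graph G1 d + G2: bilabelled_graph G2 e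
  for G1 :: "('a, 'b) bilabelled" and G2 :: "('b, 'c) bilabelled" and d e +
  assumes colours_eq: "colours G1 = vertices G2" and e_pos: "0 < e"
begin

abbreviation "Z \<equiv> graph_of (zigzag G1 G2)"

sublocale Z: pseudo_graph Z
  by (rule bilabelled_graph.pseudo_graph_graph_of, rule bilabelled_graph_zigzag)
    (unfold_locales, rule colours_eq)

lemma reachable_of_common_neighbour:
  assumes "v \<in> vertices G1" "nbhd G2 h \<inter> nbhd G2 k \<noteq> {}"
  shows "(v, h) \<rightarrow>\<^sup>*\<^bsub>Z\<^esub> (v, k)"
proof -
  obtain m where m: "m \<in> nbhd G2 h" "m \<in> nbhd G2 k"
    using assms(2) by blast
  obtain w l' where r: "rot G1 (v, m) = (w, l')" by (metis surj_pair)
  have "l' \<in> vertices G2"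
    using G1.rot_closed[of "(v, m)"] r m assms(1) by (auto simp: colours_eq nbhd_def)
  then obtain l where l: "l \<in> nbhd G2 l'"
    using G2.nbhd_nonempty e_pos by blast
  have "(v, h) \<rightarrow>\<^sup>*\<^bsub>Z\<^esub> (w, l)" "(v, k) \<rightarrow>\<^sup>*\<^bsub>Z\<^esub> (w, l)"
    using dominates_zigzag[OF _ r l assms(1)] m by blast+
  then show ?thesis
    using Z.symmetric_reachable' Z.reachable_trans by blast
qed

lemma reachable_in_fibre:
  assumes "Digraph_Component.connected (with_proj (neighborhood_graph G2))"
    and v: "v \<in> vertices G1" and h: "h \<in> vertices G2" and k: "k \<in> vertices G2"
  shows "(v, h) \<rightarrow>\<^sup>*\<^bsub>Z\<^esub> (v, k)"
proof -
  \<comment> \<open>Distinct vertices of \<open>G2\<close> may have the same neighbourhood and then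
    form one vertex of the neighbourhood graph, so \<open>P\<close> must speak about all
    representatives of \<open>N\<close>.\<close>
  define P where "P N \<longleftrightarrow> (\<forall>k\<in>vertices G2. nbhd G2 k = N \<longrightarrow> (v, h) \<rightarrow>\<^sup>*\<^bsub>Z\<^esub> (v, k))" for N
  have P_step: "P (nbhd G2 b)"
    if "P (nbhd G2 a)" "a \<in> vertices G2" "nbhd G2 a \<inter> nbhd G2 b \<noteq> {}" for a b
    unfolding P_def
  proof (intro ballI impI)
    fix k assume "nbhd G2 k = nbhd G2 b"
    then have "(v, a) \<rightarrow>\<^sup>*\<^bsub>Z\<^esub> (v, k)"
      using reachable_of_common_neighbour[OF v, of a k] that(3) by simp
    moreover have "(v, h) \<rightarrow>\<^sup>*\<^bsub>Z\<^esub> (v, a)"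
      using that(1,2) by (simp add: P_def)
    ultimately show "(v, h) \<rightarrow>\<^sup>*\<^bsub>Z\<^esub> (v, k)"
      by (rule Z.reachable_trans[rotated])
  qed
  have "P (nbhd G2 k)"
  proof (rule connected_induct[OF assms(1), of "nbhd G2 h"])
    \<comment> \<open>Reflexivity is not enough here: another \<open>k\<close> with the same
      neighbourhood as \<open>h\<close> is reached because that neighbourhood is nonempty, which
      gives a common neighbour.\<close>
    show "P (nbhd G2 h)"
      using reachable_of_common_neighbour[OF v, of h] G2.nbhd_nonempty[OF e_pos h]
      by (simp add: P_def)
  next
    fix a assume "a \<in> arcs (with_proj (neighborhood_graph G2))"
    then obtain b c where "a = (nbhd G2 b, nbhd G2 c)" "b \<in> vertices G2" "c \<in> vertices G2"
        "nbhd G2 b \<inter> nbhd G2 c \<noteq> {}"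
      by (auto simp: neighborhood_graph_def)
    then show "P (tail (with_proj (neighborhood_graph G2)) a) \<longleftrightarrow>
        P (head (with_proj (neighborhood_graph G2)) a)"
      using P_step[of b c] P_step[of c b] by (auto simp: Int_commute)
  qed (use h k in \<open>auto simp: neighborhood_graph_def\<close>)
  then show ?thesis
    using k by (simp add: P_def)
qed

lemma connected_zigzag:
  assumes conn1: "Digraph_Component.connected (graph_of G1)"
    and connN: "Digraph_Component.connected (with_proj (neighborhood_graph G2))"
  shows "Digraph_Component.connected Z"
proof -
  have ne: "vertices G1 \<noteq> {}" "vertices G2 \<noteq> {}"
    using assms by (auto simp: connected_def strongly_connected_def graph_of_def
        neighborhood_graph_def)
  have vZ: "verts Z = vertices G1 \<times> vertices G2"
    by (simp add: graph_of_def zigzag_def)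
  have "(u, h) \<rightarrow>\<^sup>*\<^bsub>Z\<^esub> (v, k)"
    if u: "u \<in> vertices G1" and v: "v \<in> vertices G1"
      and h: "h \<in> vertices G2" and k: "k \<in> vertices G2" for u v h k
  proof -
    \<comment> \<open>Asking for the whole fibre over \<open>w\<close> leaves the induction free to
      leave that fibre from any point.\<close>
    define P where "P w \<longleftrightarrow> (\<forall>k\<in>vertices G2. (u, h) \<rightarrow>\<^sup>*\<^bsub>Z\<^esub> (w, k))" for w
    have P_step: "P w" if Px: "P x" and x: "x \<in> vertices G1" and c: "c \<in> vertices G2"
      and r: "rot G1 (x, c) = (w, c')" for x w c c'
      unfolding P_def
    proof
      fix k assume k: "k \<in> vertices G2"
      have w: "w \<in> vertices G1" "c' \<in> vertices G2"
        using G1.rot_closed[of "(x, c)"] r x c by (auto simp: colours_eq)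
      \<comment> \<open>To cross the edge coloured \<open>c\<close> at \<open>x\<close>, the path
        must start at a point \<open>(x, a)\<close> whose first \<open>G2\<close>-step can end in
        \<open>c\<close>, that is, with \<open>a\<close> a neighbour of \<open>c\<close>.\<close>
      obtain a where a: "a \<in> nbhd G2 c" using G2.nbhd_nonempty[OF e_pos c] by blast
      obtain b where b: "b \<in> nbhd G2 c'" using G2.nbhd_nonempty[OF e_pos w(2)] by blast
      have ab: "a \<in> vertices G2" "b \<in> vertices G2" using a b by (auto simp: nbhd_def)
      have "(u, h) \<rightarrow>\<^sup>*\<^bsub>Z\<^esub> (x, a)" using Px ab by (simp add: P_def)
      also have "(x, a) \<rightarrow>\<^bsub>Z\<^esub> (w, b)"
        by (rule dominates_zigzag[OF G2.nbhd_sym[OF a] r b x])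
      also have "(w, b) \<rightarrow>\<^sup>*\<^bsub>Z\<^esub> (w, k)"
        by (rule reachable_in_fibre[OF connN w(1) ab(2) k])
      finally show "(u, h) \<rightarrow>\<^sup>*\<^bsub>Z\<^esub> (w, k)" .
    qed
    have "P v"
    proof (rule connected_induct[OF conn1, of u])
      show "P u"
        using reachable_in_fibre[OF connN u h] by (simp add: P_def)
    next
      fix a assume "a \<in> arcs (graph_of G1)"
      then obtain x c where a: "a = (x, c)" "x \<in> vertices G1" "c \<in> vertices G2"
        by (auto simp: graph_of_def colours_eq)
      obtain w c' where r: "rot G1 (x, c) = (w, c')" by (metis surj_pair)
      \<comment> \<open>Since the rotation map is an involution, \<open>(w, c')\<close> is the
        reversed arc, and \<open>P_step\<close> applied to it gives the converse
        implication.\<close>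
      have "w \<in> vertices G1" "c' \<in> vertices G2" "rot G1 (w, c') = (x, c)"
        using G1.rot_closed[of "(x, c)"] G1.rot_rot[of "(x, c)"] r a by (auto simp: colours_eq)
      then show "P (tail (graph_of G1) a) \<longleftrightarrow> P (head (graph_of G1) a)"
        using P_step[of x c w c'] P_step[of w c' x c] a r by (auto simp: graph_of_def)
    qed (use u v in \<open>auto simp: graph_of_def\<close>)
    then show ?thesis using k by (simp add: P_def)
  qed
  then have "strongly_connected Z"
    using ne by (auto simp: strongly_connected_def vZ)
  \<comment> \<open>Paths of \<open>Z\<close> remain paths in its symmetric closure.\<close>
  then show ?thesis
    using Z.reachable_mk_symmetricI by (auto simp: connected_def strongly_connected_def)
qed

end

theorem theorem3p1:
  fixes G1 :: "('a, 'b) bilabelled" and G2 :: "('b, 'c) bilabelled" and d e :: nat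
  assumes "bilabelled_graph G1 d"
    and "Digraph_Component.connected (graph_of G1)"
    and "bilabelled_graph G2 e" and "0 < e"
    and "Digraph_Component.connected (graph_of G2)"
    and "card (vertices G2) = d" and "colours G1 = vertices G2"
    and "Digraph_Component.connected (with_proj (neighborhood_graph G2))"
  shows "Digraph_Component.connected (graph_of (zigzag G1 G2))"
proof -
  interpret zigzag_factors G1 G2 d e
    using assms by (simp add: zigzag_factors_def zigzag_factors_axioms_def)
  show ?thesis
    using assms(2,8) by (rule connected_zigzag)
qed

end
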